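(* Let $\mathcal{S}\ge1$ and let $\alpha_1,\dots,\alpha_{\mathcal S}>0$ and $\beta_1',\dots,\beta_{\mathcal S}'>0$ be arbitrary. Let $X_1,X_2,\dots$ be i.i.d. random variables following the Moschopoulos PDF (and corresponding CDF) with shape parameters $\alpha_s$ and scale parameters $\beta_s'$, and for $\mathcal R\ge 1$ let $Y_{\mathcal R}=\max\{X_1,\dots,X_{\mathcal R}\}$. Then the common distribution of the $X_r$ belongs to the domain of attraction of the Gumbel distribution as $\mathcal R\to\infty$: there exist constants $a_{\mathcal R}>0$ and $b_{\mathcal R}\in\mathbb R$ such that for every $x\in\mathbb R$ $$\lim_{\mathcal R\to\infty}\Pr\left(\frac{Y_{\mathcal R}-b_{\mathcal R}}{a_{\mathcal R}}\le x\right)=\exp\left(-e^{-x}\right).$$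
   Context: The Moschopoulos PDF with shape parameters $\alpha_s$ and scale parameters $\beta_s'$ is the probability density of $\sum_{s=1}^{\mathcal S}G_s$, where the $G_s$ are independent Gamma random variables, $G_s$ having density $x^{\alpha_s-1}e^{-x/\beta_s'}/((\beta_s')^{\alpha_s}\Gamma(\alpha_s))$ on $x>0$. Explicitly, with $\beta_{\min}=\min_s\beta_s'$ and $\rho=\sum_{s=1}^{\mathcal S}\alpha_s$, it is $$f(y)=\prod_{s=1}^{\mathcal S}\left(\frac{\beta_{\min}}{\beta_s'}\right)^{\alpha_s}\sum_{k=0}^\infty\frac{\delta_k\,y^{\rho+k-1}e^{-y/\beta_{\min}}}{\beta_{\min}^{\rho+k}\,\Gamma(\rho+k)}\quad(y>0),\qquad f(y)=0\quad (y\le 0),$$ where $\delta_0=1$ and $\delta_{k+1}=\frac1{k+1}\sum_{i=1}^{k+1}\Bigl[\sum_{j=1}^{\mathcal S}\alpha_j\bigl(1-\beta_{\min}/\beta_j'\bigr)^i\Bigr]\delta_{k+1-i}$ for $k=0,1,2,\dots$. The parameters need not be distinct or integer-valued. *)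

theory Defs
  imports "HOL-Probability.Probability"
begin

text \<open>The shape and scale parameters are sequences of which the entries with
  index in \<^term>\<open>{1..S}\<close> are used.\<close>

definition beta_min :: "nat \<Rightarrow> (nat \<Rightarrow> real) \<Rightarrow> real" where
  "beta_min S \<beta> = Min (\<beta> ` {1..S})"

fun moschopoulos_delta :: "nat \<Rightarrow> (nat \<Rightarrow> real) \<Rightarrow> (nat \<Rightarrow> real) \<Rightarrow> nat \<Rightarrow> real" where
  "moschopoulos_delta S \<alpha> \<beta> 0 = 1"
| "moschopoulos_delta S \<alpha> \<beta> (Suc k) =
     1 / real (Suc k) *
     (\<Sum>i = 1..Suc k. (\<Sum>j = 1..S. \<alpha> j * (1 - beta_min S \<beta> / \<beta> j) ^ i)
                      * moschopoulos_delta S \<alpha> \<beta> (Suc k - i))"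

definition moschopoulos_density :: "nat \<Rightarrow> (nat \<Rightarrow> real) \<Rightarrow> (nat \<Rightarrow> real) \<Rightarrow> real \<Rightarrow> real" where
  "moschopoulos_density S \<alpha> \<beta> y =
     (let b = beta_min S \<beta>; \<rho> = (\<Sum>s = 1..S. \<alpha> s) in
      if y \<le> 0 then 0
      else (\<Prod>s = 1..S. (b / \<beta> s) powr \<alpha> s) *
           (\<Sum>k. moschopoulos_delta S \<alpha> \<beta> k * y powr (\<rho> + real k - 1) * exp (- y / b)
                 / (b powr (\<rho> + real k) * Gamma (\<rho> + real k))))"

end

theory Submission
  imports Defs
begin

text \<open>
  Up to a constant, the density is \<open>y powr (\<rho> - 1) * exp (- y / bmin) * H (y / bmin)\<close> with an
  entire power series \<open>H\<close> whose coefficients \<open>h k = \<delta> k / Gamma (\<rho> + k)\<close> are nonnegative. If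
  \<open>\<theta> = 1 - bmin / bmax\<close> is positive, then rescaling by \<open>\<theta> ^ k\<close> turns the recursion for \<open>\<delta>\<close> into
  \<open>n * d n = (\<Sum>m<n. q (n - m) * d m)\<close> with \<open>q\<close> convergent and bounded away from 0, and such a sequence
  satisfies \<open>d (n + 1) / d n \<longlonglongrightarrow> 1\<close>. So \<open>\<delta> (k + 1) / \<delta> k \<longlonglongrightarrow> \<theta>\<close>, hence the logarithmic
  derivative of \<open>H\<close> tends to \<open>\<theta>\<close>. If \<open>\<theta> = 0\<close>, then \<open>H\<close> is constant. In both cases the density \<open>f\<close>
  satisfies \<open>f (y + c) / f y \<longlongrightarrow> exp (- c / bmax)\<close>. The tail of the distribution inherits this
  ratio, which gives attraction to the Gumbel law with \<open>a R = bmax\<close> and \<open>b R\<close> the \<open>1 - 1 / R\<close>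
  quantile; precise tail asymptotics are not needed.
\<close>

section \<open>Ratio limits for sequences defined by a convolution recursion\<close>

text \<open>Subtracting consecutive instances of \<open>rec\<close> writes the increment of
  \<open>n * d n\<close> as \<open>q 1 * d n\<close> plus a sum weighted by increments of
  \<open>q\<close>, which tend to 0. The two-sided bound on \<open>q\<close> keeps
  \<open>n * d n\<close> within constant factors of the partial sums of \<open>d\<close>, so the
  whole increment is negligible against \<open>n * d n\<close>.\<close>

lemma renewal_ratio_tendsto_1:
  fixes d q :: "nat \<Rightarrow> real"
  assumes A: "A > 0" and qA: "\<And>i. i \<ge> 1 \<Longrightarrow> A \<le> q i" and qQ: "\<And>i. i \<ge> 1 \<Longrightarrow> q i \<le> Q"
    and conv: "convergent q"
    and d: "\<And>n. d n > 0"
    and rec: "\<And>n. real n * d n = (\<Sum>m<n. q (n - m) * d m)"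
  shows "(\<lambda>n. d (Suc n) / d n) \<longlonglongrightarrow> 1"
proof -
  define s where "s n = (\<Sum>m<n. d m)" for n
  have sA: "A * s n \<le> real n * d n" for n
    unfolding rec s_def sum_distrib_left using qA d
    by (intro sum_mono mult_right_mono) (auto intro: less_imp_le)
  have sQ: "real n * d n \<le> Q * s n" for n
    unfolding rec s_def sum_distrib_left using qQ d
    by (intro sum_mono mult_right_mono) (auto intro: less_imp_le)
  have smono: "s m \<le> s n" if "m \<le> n" for m n
    unfolding s_def using that d by (intro sum_mono2) (auto intro: less_imp_le)
  have Q: "Q > 0" using A qA[of 1] qQ[of 1] by simp
  have step: "real (Suc n) * d (Suc n) - real n * d n = q 1 * d n + (\<Sum>m<n. (q (Suc (n - m)) - q (n - m)) * d m)" for n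
  proof -
    have "(\<Sum>m<n. q (Suc n - m) * d m) = (\<Sum>m<n. q (Suc (n - m)) * d m)"
      by (intro sum.cong) (auto simp: Suc_diff_le)
    then show ?thesis unfolding rec by (simp add: algebra_simps sum_subtractf)
  qed
  have wlim: "(\<lambda>i. q (Suc i) - q i) \<longlonglongrightarrow> 0"
  proof -
    obtain l where l: "q \<longlonglongrightarrow> l" using conv by (auto simp: convergent_def)
    from tendsto_diff[OF LIMSEQ_Suc[OF l] l] show ?thesis by simp
  qed
  \<comment> \<open>Since \<open>n * d n\<close> and \<open>s n\<close> are comparable, each single \<open>d m\<close> with \<open>m\<close> near \<open>n\<close> is \<open>O(s n / n)\<close>;
    the remaining terms of the increment carry a small factor \<open>q (Suc i) - q i\<close>.\<close>
  define E where "E n = (real (Suc n) * d (Suc n) - real n * d n) / (real n * d n)" for n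
  have "E \<longlonglongrightarrow> 0"
  proof (rule LIMSEQ_I)
    fix r :: real assume r: "r > 0"
    \<comment> \<open>By \<open>sA\<close>, the contribution \<open>e * s n\<close> is at most a
      quarter of \<open>r * n * d n\<close>.\<close>
    define e where "e = r * A / 4"
    have e: "e > 0" using r A by (simp add: e_def)
    obtain I where I: "\<And>i. i \<ge> I \<Longrightarrow> \<bar>q (Suc i) - q i\<bar> < e"
      using LIMSEQ_D[OF wlim e] by auto
    \<comment> \<open>These are the relative sizes of two errors: the first comes from
      \<open>q 1 * d n\<close>, the second from the \<open>I\<close> latest indices. Both vanish
      because \<open>I\<close> stays fixed.\<close>
    have "(\<lambda>n. Q / real n + real I * (Q * (Q / real (n - I))) / A) \<longlonglongrightarrow> 0 + real I * (Q * 0) / A"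
    proof (intro tendsto_intros A[THEN less_imp_neq, symmetric] lim_const_over_n)
      have "(\<lambda>n. Q / real (n + I - I)) \<longlonglongrightarrow> 0" using lim_const_over_n[of Q] by simp
      then show "(\<lambda>n. Q / real (n - I)) \<longlonglongrightarrow> 0" by (rule LIMSEQ_offset)
    qed
    then have "(\<lambda>n. Q / real n + real I * (Q * (Q / real (n - I))) / A) \<longlonglongrightarrow> 0" by simp
    then have "eventually (\<lambda>n. Q / real n + real I * (Q * (Q / real (n - I))) / A < r / 2) sequentially"
      using r by (intro order_tendstoD) auto
    then have "eventually (\<lambda>n. \<bar>E n\<bar> < r) sequentially"
      using eventually_gt_at_top[of I]
    proof eventually_elim
      case (elim n)
      have n: "n > I" "n > 0" using elim by auto
      have dn: "real n * d n > 0" using d[of n] n by simp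
      have sn: "s n \<le> real n * d n / A" using sA[of n] A by (simp add: field_simps)
      \<comment> \<open>Far from \<open>n\<close> the increment of \<open>q\<close> is below
        \<open>e\<close>. For the \<open>I\<close> latest indices it is only bounded by
        \<open>Q\<close>, but there \<open>m\<close> is at least \<open>n - I\<close>, and
        \<open>sQ\<close> makes the single value \<open>d m\<close> small against
        \<open>s n\<close>.\<close>
      have bd: "\<bar>q (Suc (n - m)) - q (n - m)\<bar> * d m
          \<le> e * d m + (if m \<in> {n - I..<n} then Q * (Q / real (n - I)) * s n else 0)" if m: "m < n" for m
      proof (cases "m \<in> {n - I..<n}")
        case False
        then have "n - m \<ge> I" using m by auto
        from I[OF this] show ?thesis using False d[of m] by (auto intro!: mult_right_mono)
      next
        case True
        have "\<bar>q (Suc (n - m)) - q (n - m)\<bar> \<le> Q"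
          using qA[of "Suc (n-m)"] qQ[of "Suc (n-m)"] qA[of "n-m"] qQ[of "n-m"] m A by linarith
        moreover have "d m \<le> Q / real (n - I) * s n"
        proof -
          have "m > 0" using True n by auto
          have "real (n - I) * d m \<le> real m * d m" using True d[of m] by (intro mult_right_mono) auto
          also have "\<dots> \<le> Q * s n" using sQ[of m] smono[of m n] m Q by (meson less_imp_le mult_left_mono order_trans)
          finally show ?thesis using n by (simp add: field_simps)
        qed
        ultimately have "\<bar>q (Suc (n - m)) - q (n - m)\<bar> * d m \<le> Q * (Q / real (n - I) * s n)"
          using Q d[of m] by (intro mult_mono) auto
        moreover have "e * d m \<ge> 0" using e d[of m] by simp
        ultimately show ?thesis using True by (simp add: mult.assoc)
      qed
      have "\<bar>\<Sum>m<n. (q (Suc (n - m)) - q (n - m)) * d m\<bar> \<le> (\<Sum>m<n. \<bar>q (Suc (n - m)) - q (n - m)\<bar> * d m)"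
        by (intro order_trans[OF sum_abs] sum_mono) (simp add: abs_mult abs_of_pos[OF d])
      also have "\<dots> \<le> (\<Sum>m<n. e * d m + (if m \<in> {n - I..<n} then Q * (Q / real (n - I)) * s n else 0))"
        using bd by (intro sum_mono) auto
      also have "\<dots> = e * s n + real I * (Q * (Q / real (n - I)) * s n)"
      proof -
        have "{..<n} \<inter> {n - I..<n} = {n - I..<n}" by auto
        then have "(\<Sum>m<n. if m \<in> {n - I..<n} then x else 0) = real I * x" for x :: real
          using n by (simp only: sum.inter_restrict[symmetric] finite_lessThan) simp
        then show ?thesis by (simp only: sum.distrib s_def sum_distrib_left)
      qed
      also have "\<dots> = (e + real I * (Q * (Q / real (n - I)))) * s n" by (simp add: algebra_simps)
      also have "\<dots> \<le> (e + real I * (Q * (Q / real (n - I)))) * (real n * d n / A)"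
        using sn e Q n by (intro mult_left_mono) (auto intro!: add_nonneg_nonneg mult_nonneg_nonneg divide_nonneg_nonneg)
      finally have b1: "\<bar>\<Sum>m<n. (q (Suc (n - m)) - q (n - m)) * d m\<bar> \<le> \<dots>" .
      have "\<bar>q 1 * d n\<bar> \<le> Q * d n" using qA[of 1] qQ[of 1] A d[of n] by (simp add: abs_mult)
      with b1 have "\<bar>real (Suc n) * d (Suc n) - real n * d n\<bar> \<le> Q * d n + (e + real I * (Q * (Q / real (n - I)))) * (real n * d n / A)"
        unfolding step by linarith
      also have "\<dots> = (Q / real n + real I * (Q * (Q / real (n - I))) / A + e / A) * (real n * d n)"
        using n A by (simp add: field_simps)
      also have "\<dots> < (r / 2 + r / 2) * (real n * d n)"
      proof (rule mult_strict_right_mono[OF _ dn])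
        have "e / A < r / 2" using A r by (simp add: e_def)
        then show "Q / real n + real I * (Q * (Q / real (n - I))) / A + e / A < r / 2 + r / 2" using elim by linarith
      qed
      finally show ?case using dn by (simp add: E_def abs_divide divide_less_eq del: of_nat_Suc)
    qed
    then show "\<exists>no. \<forall>n\<ge>no. norm (E n - 0) < r" by (simp add: eventually_sequentially)
  qed
  \<comment> \<open>For positive \<open>n\<close>, \<open>1 + E n\<close> is the quotient of
    \<open>(n + 1) * d (n + 1)\<close> by \<open>n * d n\<close>; the second factor cancels the
    index weights.\<close>
  then have "(\<lambda>n. (1 + E n) * (real n / real (Suc n))) \<longlonglongrightarrow> (1 + 0) * 1"
    by (intro tendsto_intros LIMSEQ_n_over_Suc_n)
  moreover have "eventually (\<lambda>n. (1 + E n) * (real n / real (Suc n)) = d (Suc n) / d n) sequentially"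
    using eventually_gt_at_top[of 0]
  proof eventually_elim
    case (elim n)
    have "real n * d n \<noteq> 0" using elim d[of n] by simp
    then have "1 + E n = real (Suc n) * d (Suc n) / (real n * d n)" unfolding E_def by (simp add: field_simps)
    then show ?case using elim d[of n] by simp
  qed
  ultimately show ?thesis using Lim_transform_eventually by fastforce
qed

section \<open>Growth of entire power series with positive coefficients\<close>

text \<open>The coefficient \<open>(k + 1) * h (k + 1)\<close> of the derivative is asymptotically
  \<open>\<theta> * h k\<close>. Since all terms are positive for positive \<open>z\<close>, this
  passes to the sums: the logarithmic derivative tends to \<open>\<theta>\<close>. Integrating it
  over a step of length \<open>c\<close> gives the limit.\<close>

lemma power_series_growth_ratio:
  fixes h :: "nat \<Rightarrow> real"
  assumes h: "\<And>k. h k > 0" and lim: "(\<lambda>k. real (Suc k) * h (Suc k) / h k) \<longlonglongrightarrow> \<theta>"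
  defines "H \<equiv> \<lambda>z. \<Sum>k. h k * z ^ k"
  shows "summable (\<lambda>k. h k * z ^ k)"
    and "((\<lambda>z. H (z + c) / H z) \<longlongrightarrow> exp (\<theta> * c)) at_top"
proof -
  have summ: "summable (\<lambda>k. h k * z ^ k)" for z
  proof (cases "z = 0")
    case True
    then show ?thesis by (simp add: summable_0_powser)
  next
    case False
    \<comment> \<open>The hypothesis makes \<open>h (k + 1) / h k\<close> at most of order
      \<open>1 / k\<close>, so the ratio test applies for every \<open>z\<close>.\<close>
    have "(\<lambda>k. (real (Suc k) * h (Suc k) / h k) * inverse (real (Suc k)) * \<bar>z\<bar>) \<longlonglongrightarrow> \<theta> * 0 * \<bar>z\<bar>"
      by (intro tendsto_intros lim LIMSEQ_inverse_real_of_nat)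
    then have "(\<lambda>k. \<bar>z\<bar> * h (Suc k) / h k) \<longlonglongrightarrow> 0"
      by (simp add: field_simps del: of_nat_Suc)
    then have "eventually (\<lambda>k. \<bar>z\<bar> * h (Suc k) / h k < 1/2) sequentially"
      by (intro order_tendstoD) auto
    then obtain N where N: "\<And>k. k \<ge> N \<Longrightarrow> \<bar>z\<bar> * h (Suc k) / h k < 1/2"
      by (auto simp: eventually_sequentially)
    show ?thesis
    proof (rule summable_ratio_test[of "1/2" N])
      fix k assume "k \<ge> N"
      from N[OF this] have "\<bar>z\<bar> * h (Suc k) \<le> 1/2 * h k" using h[of k] by (simp add: divide_less_eq)
      from mult_right_mono[OF this, of "\<bar>z\<bar> ^ k"] h[of k] h[of "Suc k"]
      show "norm (h (Suc k) * z ^ Suc k) \<le> 1/2 * norm (h k * z ^ k)"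
        by (simp add: abs_mult power_abs algebra_simps)
    qed auto
  qed
  show "summable (\<lambda>k. h k * z ^ k)" by (rule summ)
  define H' where "H' z = (\<Sum>k. diffs h k * z ^ k)" for z
  have der: "(H has_field_derivative H' z) (at z)" for z
    unfolding H_def H'_def by (rule termdiffs_strong_converges_everywhere[OF summ])
  have summ': "summable (\<lambda>k. diffs h k * z ^ k)" for z
    using termdiff_converges_all[OF summ] .
  have Hge: "h k * z ^ k \<le> H z" if "z \<ge> 0" for k z
    unfolding H_def using sum_le_suminf[OF summ, of "{k}" z] h that by (simp add: less_imp_le)
  have Hpos: "H z > 0" if "z \<ge> 0" for z using Hge[OF that, of 0] h[of 0] by simp
  have main: "((\<lambda>z. H' z / H z) \<longlongrightarrow> \<theta>) at_top"
  proof (rule tendstoI)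
    fix e :: real assume e: "e > 0"
    \<comment> \<open>The coefficients of \<open>H' - \<theta> * H\<close>; from some
      \<open>K\<close> on they are small relative to those of \<open>H\<close>.\<close>
    define u where "u k = diffs h k - \<theta> * h k" for k
    obtain K where K: "\<And>k. k \<ge> K \<Longrightarrow> \<bar>u k\<bar> \<le> e / 2 * h k"
    proof -
      from LIMSEQ_D[OF lim, of "e/2"] e obtain K where K: "\<And>k. k \<ge> K \<Longrightarrow> \<bar>real (Suc k) * h (Suc k) / h k - \<theta>\<bar> < e / 2" by auto
      have "\<bar>u k\<bar> \<le> e / 2 * h k" if "k \<ge> K" for k
      proof -
        have "u k = (real (Suc k) * h (Suc k) / h k - \<theta>) * h k" using h[of k] by (simp add: u_def diffs_def left_diff_distrib del: of_nat_Suc)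
        then have "\<bar>u k\<bar> = \<bar>real (Suc k) * h (Suc k) / h k - \<theta>\<bar> * h k" using h[of k] by (simp add: abs_mult)
        then show ?thesis using K[OF that] h[of k] by (simp add: mult_right_mono del: of_nat_Suc)
      qed
      then show ?thesis by (rule that)
    qed
    define C where "C = (\<Sum>k<K. \<bar>u k\<bar>)"
    \<comment> \<open>The terms below \<open>K\<close> form a polynomial of degree less than
      \<open>K\<close>. Comparing it with the single term \<open>h K * z ^ K\<close> of
      \<open>H\<close> gains a factor \<open>1 / z\<close>.\<close>
    have "((\<lambda>z::real. C / h K * inverse z) \<longlongrightarrow> C / h K * 0) at_top"
      by (intro tendsto_intros tendsto_inverse_0_at_top filterlim_ident)
    then have "eventually (\<lambda>z. C / h K * inverse z < e / 2) at_top"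
      using e by (intro order_tendstoD) auto
    then show "eventually (\<lambda>z. dist (H' z / H z) \<theta> < e) at_top"
      using eventually_ge_at_top[of 1]
    proof eventually_elim
      case (elim z)
      have z: "z \<ge> 1" "z \<ge> 0" using elim by auto
      have su: "(\<lambda>k. u k * z ^ k) sums (H' z - \<theta> * H z)"
        unfolding H'_def H_def u_def left_diff_distrib mult.assoc
        by (intro sums_diff sums_mult summable_sums summ summ')
      define F where "F k = (if k < K then \<bar>u k\<bar> * z ^ k else 0)" for k
      have F: "F sums (\<Sum>k<K. \<bar>u k\<bar> * z ^ k)"
        unfolding F_def using sums_If_finite_set[of "{..<K}"] by simp
      have G: "(\<lambda>k. e / 2 * (h k * z ^ k)) sums (e / 2 * H z)"
        unfolding H_def by (intro sums_mult summable_sums summ)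
      have b: "\<bar>u k * z ^ k\<bar> \<le> F k + e / 2 * (h k * z ^ k)" for k
        using K[of k] z h[of k] e by (auto simp: F_def abs_mult mult.assoc[symmetric] intro!: mult_right_mono)
      have "\<bar>H' z - \<theta> * H z\<bar> \<le> (\<Sum>k<K. \<bar>u k\<bar> * z ^ k) + e / 2 * H z"
      proof (rule abs_leI)
        show "H' z - \<theta> * H z \<le> (\<Sum>k<K. \<bar>u k\<bar> * z ^ k) + e / 2 * H z"
          using b by (intro sums_le[OF _ su sums_add[OF F G]]) (auto simp: abs_le_iff)
        show "- (H' z - \<theta> * H z) \<le> (\<Sum>k<K. \<bar>u k\<bar> * z ^ k) + e / 2 * H z"
          using b by (intro sums_le[OF _ sums_minus[OF su] sums_add[OF F G]]) (auto simp: abs_le_iff)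
      qed
      also have "(\<Sum>k<K. \<bar>u k\<bar> * z ^ k) \<le> C / h K * inverse z * H z"
      proof -
        have "(\<Sum>k<K. \<bar>u k\<bar> * z ^ k) \<le> (\<Sum>k<K. \<bar>u k\<bar> * (z ^ K * inverse z))"
        proof (intro sum_mono mult_left_mono)
          fix k assume "k \<in> {..<K}"
          then have "z ^ Suc k \<le> z ^ K" using z by (intro power_increasing) auto
          then show "z ^ k \<le> z ^ K * inverse z" using z by (simp add: field_simps)
        qed auto
        also have "\<dots> = C / h K * inverse z * (h K * z ^ K)" using h[of K] by (simp add: C_def sum_distrib_right[symmetric])
        also have "\<dots> \<le> C / h K * inverse z * H z"
          using Hge[OF z(2)] h[of K] z by (intro mult_left_mono mult_nonneg_nonneg divide_nonneg_nonneg) (auto simp: C_def intro: sum_nonneg less_imp_le)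
        finally show ?thesis .
      qed
      also have "C / h K * inverse z * H z + e / 2 * H z < e / 2 * H z + e / 2 * H z"
        using elim Hpos[OF z(2)] by (intro add_strict_right_mono mult_strict_right_mono) auto
      finally have "\<bar>H' z - \<theta> * H z\<bar> < e * H z" by simp
      moreover have "H' z / H z - \<theta> = (H' z - \<theta> * H z) / H z" using Hpos[OF z(2)] by (simp add: field_simps)
      ultimately show ?case using Hpos[OF z(2)] by (simp add: dist_real_def abs_divide divide_less_eq)
    qed
  qed
  \<comment> \<open>With the expected slope removed, the derivative \<open>H' / H - \<theta>\<close>
    tends to 0, so \<open>\<phi>\<close> changes by a vanishing amount over a step of fixed
    length.\<close>
  define \<phi> where "\<phi> z = ln (H z) - \<theta> * z" for z
  have "((\<lambda>z. \<phi> (z + c) - \<phi> z) \<longlongrightarrow> 0) at_top"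
  proof (rule tendstoI)
    fix e :: real assume e: "e > 0"
    define r where "r = e / (1 + \<bar>c\<bar>)"
    have r: "r > 0" using e by (simp add: r_def)
    have "r * (1 + \<bar>c\<bar>) = e" by (simp add: r_def)
    then have rc: "r * \<bar>c\<bar> < e" using r by (simp add: algebra_simps)
    obtain Z where Z: "\<And>z. z \<ge> Z \<Longrightarrow> \<bar>H' z / H z - \<theta>\<bar> < r"
      using tendstoD[OF main r] by (auto simp: eventually_at_top_linorder dist_real_def)
    \<comment> \<open>Taking \<open>W\<close> nonnegative keeps \<open>H\<close> positive on the
      half-line; starting at \<open>W + \<bar>c\<bar>\<close> keeps both \<open>z\<close> and
      \<open>z + c\<close> inside it.\<close>
    define W where "W = max Z 0"
    show "eventually (\<lambda>z. dist (\<phi> (z + c) - \<phi> z) 0 < e) at_top"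
      using eventually_ge_at_top[of "W + \<bar>c\<bar>"]
    proof eventually_elim
      case (elim z)
      have "norm (\<phi> (z + c) - \<phi> z) \<le> r * norm (z + c - z)"
      proof (rule field_differentiable_bound[of "{W..}"])
        fix x assume x: "x \<in> {W..}"
        then have "x \<ge> 0" by (simp add: W_def)
        from Hpos[OF this] have "H x > 0" .
        then show "(\<phi> has_field_derivative (H' x / H x - \<theta>)) (at x within {W..})"
          unfolding \<phi>_def by (auto intro!: derivative_eq_intros DERIV_subset[OF der])
        show "norm (H' x / H x - \<theta>) \<le> r" using Z[of x] x by (auto simp: W_def)
      qed (use elim in auto)
      also have "\<dots> = r * \<bar>c\<bar>" by simp
      finally show ?case using rc by simp
    qed
  qed
  then have "((\<lambda>z. exp (\<theta> * c + (\<phi> (z + c) - \<phi> z))) \<longlongrightarrow> exp (\<theta> * c + 0)) at_top"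
    by (intro tendsto_intros)
  moreover have "eventually (\<lambda>z. exp (\<theta> * c + (\<phi> (z + c) - \<phi> z)) = H (z + c) / H z) at_top"
    using eventually_ge_at_top[of "\<bar>c\<bar>"]
  proof eventually_elim
    case (elim z)
    have p: "H (z + c) > 0" "H z > 0" using elim by (auto intro!: Hpos)
    have "\<theta> * c + (\<phi> (z + c) - \<phi> z) = ln (H (z + c)) - ln (H z)" by (simp add: \<phi>_def algebra_simps)
    then show ?case using p by (simp add: exp_diff)
  qed
  ultimately show "((\<lambda>z. H (z + c) / H z) \<longlongrightarrow> exp (\<theta> * c)) at_top"
    by (simp cong: filterlim_cong add: Lim_transform_eventually)
qed

section \<open>The Moschopoulos coefficients and the shift ratio of the density\<close>

text \<open>Clearing the factor \<open>1 / (k + 1)\<close> and substituting \<open>m = n - i\<close>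
  brings the recursion into the shape that \<open>renewal_ratio_tendsto_1\<close> expects, with
  \<open>n = 0\<close> included.\<close>

lemma moschopoulos_delta_convolution:
  "real n * moschopoulos_delta S \<alpha> \<beta> n =
    (\<Sum>m<n. (\<Sum>j = 1..S. \<alpha> j * (1 - beta_min S \<beta> / \<beta> j) ^ (n - m)) * moschopoulos_delta S \<alpha> \<beta> m)"
proof (cases n)
  case (Suc k)
  let ?p = "\<lambda>i. \<Sum>j = 1..S. \<alpha> j * (1 - beta_min S \<beta> / \<beta> j) ^ i"
  have "real n * moschopoulos_delta S \<alpha> \<beta> n = (\<Sum>i = 1..n. ?p i * moschopoulos_delta S \<alpha> \<beta> (n - i))"
    unfolding Suc by (simp del: of_nat_Suc sum.cl_ivl_Suc)
  also have "\<dots> = (\<Sum>m<n. ?p (n - m) * moschopoulos_delta S \<alpha> \<beta> m)"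
    by (rule sum.reindex_bij_witness[where i = "\<lambda>m. n - m" and j = "\<lambda>i. n - i"]) auto
  finally show ?thesis .
qed simp

locale moschopoulos =
  fixes S :: nat and \<alpha> \<beta> :: "nat \<Rightarrow> real"
  assumes S: "S \<ge> 1"
    and \<alpha>: "\<And>s. s \<in> {1..S} \<Longrightarrow> \<alpha> s > 0"
    and \<beta>: "\<And>s. s \<in> {1..S} \<Longrightarrow> \<beta> s > 0"
begin

abbreviation "bmin \<equiv> beta_min S \<beta>"
abbreviation "\<delta> \<equiv> moschopoulos_delta S \<alpha> \<beta>"

definition "bmax = Max (\<beta> ` {1..S})"
definition "\<rho> = (\<Sum>s = 1..S. \<alpha> s)"
text \<open>The largest of the bases \<open>1 - bmin / \<beta> j\<close>, hence the dominant
  geometric rate in the recursion for \<open>\<delta>\<close>. It is 0 exactly when all scales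
  agree.\<close>

definition "\<theta> = 1 - bmin / bmax"
definition "h k = \<delta> k / Gamma (\<rho> + real k)"
definition "H z = (\<Sum>k. h k * z ^ k)"

lemma bmin_pos: "bmin > 0"
  unfolding beta_min_def using S \<beta> by (subst Min_gr_iff) auto

lemma bmin_le: "s \<in> {1..S} \<Longrightarrow> bmin \<le> \<beta> s"
  unfolding beta_min_def by (intro Min_le) auto

lemma le_bmax: "s \<in> {1..S} \<Longrightarrow> \<beta> s \<le> bmax"
  unfolding bmax_def by (intro Max_ge) auto

lemma bmax_attained: obtains s where "s \<in> {1..S}" "\<beta> s = bmax"
proof -
  have "bmax \<in> \<beta> ` {1..S}" unfolding bmax_def using S by (intro Max_in) auto
  then show ?thesis using that by auto
qed

lemma bmax_pos: "bmax > 0"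
  using \<beta> bmax_attained by metis

lemma \<rho>_pos: "\<rho> > 0"
  unfolding \<rho>_def using S \<alpha> by (intro sum_pos) auto

lemma theta_nonneg: "\<theta> \<ge> 0"
  using bmin_le bmax_pos bmax_attained unfolding \<theta>_def by (metis diff_ge_0_iff_ge divide_le_eq_1_pos)

lemma theta_s: assumes "s \<in> {1..S}" shows "0 \<le> 1 - bmin / \<beta> s" "1 - bmin / \<beta> s \<le> \<theta>"
  using bmin_le[OF assms] le_bmax[OF assms] \<beta>[OF assms] bmin_pos unfolding \<theta>_def
  by (auto intro!: divide_left_mono mult_pos_pos bmax_pos)

lemma delta_eq_0:
  assumes "\<theta> = 0" "k > 0" shows "\<delta> k = 0"
proof -
  have "real k * \<delta> k = 0"
    unfolding moschopoulos_delta_convolution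
  proof (intro sum.neutral ballI)
    fix m assume "m \<in> {..<k}"
    moreover have "1 - bmin / \<beta> j = 0" if "j \<in> {1..S}" for j
      using theta_s[OF that] assms by simp
    ultimately have "(\<Sum>j = 1..S. \<alpha> j * (1 - bmin / \<beta> j) ^ (k - m)) = 0"
      by (intro sum.neutral ballI) (simp only: zero_power zero_less_diff lessThan_iff mult_zero_right)
    then show "(\<Sum>j = 1..S. \<alpha> j * (1 - bmin / \<beta> j) ^ (k - m)) * \<delta> m = 0" by simp
  qed
  then show ?thesis using assms by simp
qed

text \<open>After division by \<open>\<theta> ^ n\<close> the weights become sums of powers of
  numbers in the unit interval. Such powers converge, and a component of maximal scale has base 1,
  which bounds the weights below by its shape parameter. This is the setting of the renewal
  lemma.\<close>

lemma
  assumes "\<theta> > 0"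
  shows delta_pos: "\<delta> n > 0"
    and delta_ratio: "(\<lambda>n. \<delta> (Suc n) / \<delta> n) \<longlonglongrightarrow> \<theta>"
proof -
  obtain s where s: "s \<in> {1..S}" "\<beta> s = bmax" by (rule bmax_attained)
  define d where "d n = \<delta> n / \<theta> ^ n" for n
  define q where "q i = (\<Sum>j = 1..S. \<alpha> j * ((1 - bmin / \<beta> j) / \<theta>) ^ i)" for i
  have rec: "real n * d n = (\<Sum>m<n. q (n - m) * d m)" for n
  proof -
    have "real n * d n = (\<Sum>m<n. (\<Sum>j = 1..S. \<alpha> j * (1 - bmin / \<beta> j) ^ (n - m)) * \<delta> m / \<theta> ^ n)"
      unfolding d_def times_divide_eq_right moschopoulos_delta_convolution sum_divide_distrib ..
    also have "\<dots> = (\<Sum>m<n. q (n - m) * d m)"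
    proof (intro sum.cong refl)
      fix m assume "m \<in> {..<n}"
      then have "\<theta> ^ n = \<theta> ^ (n - m) * \<theta> ^ m" by (simp flip: power_add)
      then show "(\<Sum>j = 1..S. \<alpha> j * (1 - bmin / \<beta> j) ^ (n - m)) * \<delta> m / \<theta> ^ n = q (n - m) * d m"
        by (simp add: q_def d_def power_divide flip: sum_divide_distrib)
    qed
    finally show ?thesis .
  qed
  have x: "0 \<le> (1 - bmin / \<beta> j) / \<theta>" "(1 - bmin / \<beta> j) / \<theta> \<le> 1" if "j \<in> {1..S}" for j
    using theta_s[OF that] assms by auto
  have qA: "\<alpha> s \<le> q i" for i
  proof -
    have "1 - bmin / \<beta> s = \<theta>" using s by (simp add: \<theta>_def)
    then have "(1 - bmin / \<beta> s) / \<theta> = 1" using assms by simp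
    then have "\<alpha> s = \<alpha> s * ((1 - bmin / \<beta> s) / \<theta>) ^ i" by (simp only: power_one mult_1_right)
    also have "\<dots> \<le> q i" unfolding q_def
      using s \<alpha> x by (intro member_le_sum mult_nonneg_nonneg zero_le_power) (auto intro: less_imp_le)
    finally show ?thesis .
  qed
  have qQ: "q i \<le> \<rho>" for i
    unfolding q_def \<rho>_def using \<alpha> x by (intro sum_mono mult_left_le power_le_one) (auto intro: less_imp_le)
  have "convergent (\<lambda>i. ((1 - bmin / \<beta> j) / \<theta>) ^ i)" if "j \<in> {1..S}" for j
    using x[OF that] by (cases "(1 - bmin / \<beta> j) / \<theta> = 1") (auto intro: convergent_realpow convergent_const)
  then have conv: "convergent q" unfolding q_def
    by (intro convergent_sum convergent_mult convergent_const) auto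
  have dpos: "d n > 0" for n
  proof (induction n rule: less_induct)
    case (less n)
    show ?case
    proof (cases "n = 0")
      case True
      then show ?thesis by (simp add: d_def)
    next
      case False
      have "0 < (\<Sum>m<n. q (n - m) * d m)"
        using False less qA \<alpha>[OF s(1)] by (intro sum_pos mult_pos_pos) (auto intro: less_le_trans)
      then have "0 < real n * d n" unfolding rec .
      then show ?thesis using False by (simp add: zero_less_mult_iff)
    qed
  qed
  from dpos show "\<delta> n > 0" using assms by (simp add: d_def zero_less_divide_iff)
  have "(\<lambda>n. d (Suc n) / d n) \<longlonglongrightarrow> 1"
    by (rule renewal_ratio_tendsto_1[OF \<alpha>[OF s(1)] qA qQ conv dpos rec])
  then have "(\<lambda>n. \<theta> * (d (Suc n) / d n)) \<longlonglongrightarrow> \<theta> * 1" by (intro tendsto_intros)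
  moreover have "\<theta> * (d (Suc n) / d n) = \<delta> (Suc n) / \<delta> n" for n
    using assms by (simp add: d_def field_simps del: moschopoulos_delta.simps)
  ultimately show "(\<lambda>n. \<delta> (Suc n) / \<delta> n) \<longlonglongrightarrow> \<theta>"
    by (simp del: moschopoulos_delta.simps)
qed

lemma h_pos: assumes "\<theta> > 0" shows "h k > 0"
  unfolding h_def using delta_pos[OF assms] \<rho>_pos by (intro divide_pos_pos Gamma_real_pos) auto

lemma h_0_pos: "h 0 > 0"
  unfolding h_def using \<rho>_pos by (simp add: Gamma_real_pos)

lemma h_nonneg: "h k \<ge> 0"
  using h_pos[of k] h_0_pos theta_nonneg delta_eq_0[of k] by (cases "k = 0") (force simp: h_def)+

text \<open>The functional equation of Gamma contributes the factor \<open>1 / (\<rho> + k)\<close>,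
  which balances the weight \<open>k + 1\<close> and leaves the limit of the \<open>\<delta>\<close>
  quotients.\<close>

lemma h_ratio:
  assumes "\<theta> > 0"
  shows "(\<lambda>k. real (Suc k) * h (Suc k) / h k) \<longlonglongrightarrow> \<theta>"
proof -
  have "(\<lambda>k. 1 / (1 + (\<rho> - 1) * inverse (real (Suc k)))) \<longlonglongrightarrow> 1 / (1 + (\<rho> - 1) * 0)"
    by (intro tendsto_intros LIMSEQ_inverse_real_of_nat) simp
  moreover have "1 / (1 + (\<rho> - 1) * inverse (real (Suc k))) = real (Suc k) / (\<rho> + real k)" for k
    using \<rho>_pos by (simp add: field_simps)
  ultimately have "(\<lambda>k. real (Suc k) / (\<rho> + real k)) \<longlonglongrightarrow> 1" by simp
  from tendsto_mult[OF this delta_ratio[OF assms]]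
  have "(\<lambda>k. real (Suc k) / (\<rho> + real k) * (\<delta> (Suc k) / \<delta> k)) \<longlonglongrightarrow> \<theta>" by simp
  moreover have "real (Suc k) / (\<rho> + real k) * (\<delta> (Suc k) / \<delta> k) = real (Suc k) * h (Suc k) / h k" for k
  proof -
    have p: "\<rho> + real k > 0" using \<rho>_pos by simp
    then have "\<rho> + real k \<notin> \<int>\<^sub>\<le>\<^sub>0" by (auto elim!: nonpos_Ints_cases)
    from Gamma_plus1[OF this] have "Gamma (\<rho> + real (Suc k)) = (\<rho> + real k) * Gamma (\<rho> + real k)"
      by (simp add: algebra_simps)
    then show ?thesis
      unfolding h_def using p Gamma_real_pos[OF p, THEN less_imp_neq] delta_pos[OF assms, of k]
      by (simp del: of_nat_Suc moschopoulos_delta.simps)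
  qed
  ultimately show ?thesis by simp
qed

lemma H_const: assumes "\<theta> = 0" shows "(\<lambda>k. h k * z ^ k) sums h 0"
proof -
  have "h k * z ^ k = 0" if "k \<notin> {0}" for k using delta_eq_0[OF assms, of k] that by (simp add: h_def)
  from sums_finite[of "{0}" "\<lambda>k. h k * z ^ k", OF _ this] show ?thesis by simp
qed

lemma h_summable: "summable (\<lambda>k. h k * z ^ k)"
  using power_series_growth_ratio(1)[OF h_pos h_ratio] H_const[of z] theta_nonneg
  by (cases "\<theta> = 0") (auto simp: sums_iff)

lemma H_pos: assumes "z \<ge> 0" shows "H z > 0"
  unfolding H_def using sum_le_suminf[OF h_summable, of "{0}" z] h_0_pos h_nonneg assms
  by (auto intro: less_le_trans)

lemma H_ratio: "((\<lambda>z. H (z + c) / H z) \<longlongrightarrow> exp (\<theta> * c)) at_top"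
proof (cases "\<theta> = 0")
  case True
  then have "H z = h 0" for z unfolding H_def using H_const[OF True] by (simp add: sums_iff)
  then show ?thesis using h_0_pos True by simp
next
  case False
  then have "\<theta> > 0" using theta_nonneg by simp
  from power_series_growth_ratio(2)[OF h_pos[OF this] h_ratio[OF this]] show ?thesis by (simp add: H_def)
qed

definition "K = (\<Prod>s = 1..S. (bmin / \<beta> s) powr \<alpha> s) / bmin powr \<rho>"

lemma K_pos: "K > 0"
  unfolding K_def using bmin_pos \<beta> by (intro divide_pos_pos prod_pos) (force simp: powr_gt_zero)+

lemma density_eq:
  assumes "y > 0"
  shows "moschopoulos_density S \<alpha> \<beta> y = K * y powr (\<rho> - 1) * exp (- y / bmin) * H (y / bmin)"
proof -
  have "\<delta> k * y powr (\<rho> + real k - 1) * exp (- y / bmin) / (bmin powr (\<rho> + real k) * Gamma (\<rho> + real k))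
      = (y powr (\<rho> - 1) * exp (- y / bmin) / bmin powr \<rho>) * (h k * (y / bmin) ^ k)" for k
  proof -
    have "\<rho> + real k - 1 = (\<rho> - 1) + real k" by simp
    then have "y powr (\<rho> + real k - 1) = y powr (\<rho> - 1) * y ^ k"
      using assms by (simp only: powr_add powr_realpow)
    moreover have "bmin powr (\<rho> + real k) = bmin powr \<rho> * bmin ^ k"
      using bmin_pos by (simp only: powr_add powr_realpow)
    ultimately show ?thesis by (simp add: h_def power_divide mult_ac)
  qed
  then show ?thesis using assms
    unfolding moschopoulos_density_def Let_def \<rho>_def[symmetric] K_def H_def
    by (simp only: suminf_mult[OF h_summable]) simp
qed

lemma density_pos: assumes "y > 0" shows "moschopoulos_density S \<alpha> \<beta> y > 0"
  unfolding density_eq[OF assms] using assms bmin_pos by (intro mult_pos_pos K_pos H_pos) auto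

text \<open>The power factor contributes 1, the exponential \<open>exp (- c / bmin)\<close>, and the
  series \<open>exp (\<theta> * c / bmin)\<close>. By the choice of \<open>\<theta>\<close> the
  exponents add up to \<open>- c / bmax\<close>.\<close>

lemma density_ratio:
  "((\<lambda>y. moschopoulos_density S \<alpha> \<beta> (y + c) / moschopoulos_density S \<alpha> \<beta> y) \<longlongrightarrow> exp (- c / bmax)) at_top"
proof -
  have "filterlim (\<lambda>y. inverse bmin * y) at_top at_top"
    using bmin_pos by (intro filterlim_tendsto_pos_mult_at_top[OF tendsto_const] filterlim_ident) auto
  then have "filterlim (\<lambda>y. y / bmin) at_top at_top" by (simp add: field_simps)
  from filterlim_compose[OF H_ratio[of "c / bmin"] this]
  have 1: "((\<lambda>y. H (y / bmin + c / bmin) / H (y / bmin)) \<longlongrightarrow> exp (\<theta> * (c / bmin))) at_top" .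
  have "((\<lambda>y. 1 + c * inverse y) \<longlongrightarrow> 1 + c * 0) at_top"
    by (intro tendsto_intros tendsto_inverse_0_at_top filterlim_ident)
  moreover have "eventually (\<lambda>y. 1 + c * inverse y = (y + c) / y) at_top"
    using eventually_gt_at_top[of 0] by eventually_elim (simp add: field_simps)
  ultimately have "((\<lambda>y. (y + c) / y) \<longlongrightarrow> 1) at_top"
    using Lim_transform_eventually by fastforce
  from tendsto_powr[OF this tendsto_const, of "\<rho> - 1"]
  have 2: "((\<lambda>y. ((y + c) / y) powr (\<rho> - 1)) \<longlongrightarrow> 1) at_top" by simp
  have "((\<lambda>y. exp (- c / bmin) * ((y + c) / y) powr (\<rho> - 1) * (H (y / bmin + c / bmin) / H (y / bmin)))
      \<longlongrightarrow> exp (- c / bmin) * 1 * exp (\<theta> * (c / bmin))) at_top"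
    by (intro tendsto_intros 1 2)
  also have "exp (- c / bmin) * 1 * exp (\<theta> * (c / bmin)) = exp (- c / bmax)"
    using bmin_pos bmax_pos by (simp add: \<theta>_def field_simps flip: exp_add)
  finally have "((\<lambda>y. exp (- c / bmin) * ((y + c) / y) powr (\<rho> - 1) * (H (y / bmin + c / bmin) / H (y / bmin)))
      \<longlongrightarrow> exp (- c / bmax)) at_top" .
  moreover have "eventually (\<lambda>y. exp (- c / bmin) * ((y + c) / y) powr (\<rho> - 1) * (H (y / bmin + c / bmin) / H (y / bmin))
      = moschopoulos_density S \<alpha> \<beta> (y + c) / moschopoulos_density S \<alpha> \<beta> y) at_top"
    using eventually_gt_at_top[of "\<bar>c\<bar>"]
  proof eventually_elim
    case (elim y)
    then have y: "y > 0" "y + c > 0" by auto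
    have "- (y + c) / bmin = - c / bmin + - y / bmin" by (simp add: add_divide_distrib diff_divide_distrib)
    then have e: "exp (- (y + c) / bmin) = exp (- c / bmin) * exp (- y / bmin)" by (simp only: exp_add)
    have p: "((y + c) / y) powr (\<rho> - 1) = (y + c) powr (\<rho> - 1) / y powr (\<rho> - 1)"
      using y by (intro powr_divide)
    show ?case unfolding density_eq[OF y(1)] density_eq[OF y(2)] e p
      using y K_pos by (simp add: add_divide_distrib)
  qed
  ultimately show ?thesis by (rule Lim_transform_eventually)
qed

end

section \<open>From density ratios to tail ratios and the Gumbel limit\<close>

text \<open>For large \<open>t\<close>, \<open>f (t + c)\<close> differs from \<open>L * f t\<close>
  by at most a small multiple of \<open>f t\<close>; integrating this over \<open>t > y\<close>
  gives the same relative bound for the tails.\<close>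

lemma tail_integral_ratio:
  fixes f :: "real \<Rightarrow> real"
  assumes int: "integrable lborel f" and pos: "\<And>y. y > 0 \<Longrightarrow> f y > 0"
    and lim: "((\<lambda>y. f (y + c) / f y) \<longlongrightarrow> L) at_top"
  defines "T \<equiv> \<lambda>y. LINT t|lborel. indicator {y<..} t * f t"
  shows "((\<lambda>y. T (y + c) / T y) \<longlongrightarrow> L) at_top" and "y \<ge> 0 \<Longrightarrow> T y > 0"
proof -
  have int': "integrable lborel (\<lambda>t. indicator {y<..} t * f t)" for y
    using integrable_mult_indicator[OF _ int, of "{y<..}"] by simp
  have Tpos: "T y > 0" if "y \<ge> 0" for y
  proof -
    have nn: "AE t in lborel. 0 \<le> indicator {y<..} t * f t"
      using pos that by (auto simp: indicator_def intro!: AE_I2 less_imp_le)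
    \<comment> \<open>Otherwise \<open>f\<close> would vanish almost everywhere beyond
      \<open>y\<close>, although it is positive on an interval of length 1 there.\<close>
    have "T y \<noteq> 0"
    proof
      assume "T y = 0"
      then have "AE t in lborel. indicator {y<..} t * f t = 0"
        unfolding T_def using integral_nonneg_eq_0_iff_AE[OF int' nn] by simp
      then have "AE t in lborel. t \<notin> {y<..}"

      proof eventually_elim
        case (elim t)
        then show ?case using pos[of t] that by (cases "t > y") auto
      qed
      then have "AE t in lborel. \<not> t \<in> {y<..<y+1}" by eventually_elim auto
      from emeasure_eq_0_AE[OF this] have "emeasure lborel {y<..<y+1} = 0"
        by (simp only: space_lborel space_borel UNIV_I simp_thms Collect_mem_eq)
      then show False by simp
    qed
    moreover have "T y \<ge> 0" unfolding T_def by (rule integral_nonneg_AE[OF nn])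
    ultimately show ?thesis by simp
  qed
  then show "y \<ge> 0 \<Longrightarrow> T y > 0" .
  have shift: "T (y + c) = (LINT t|lborel. indicator {y<..} t * f (t + c))" for y
  proof -
    have "T (y + c) = (LINT t|lborel. indicator {y + c<..} (c + t) * f (c + t))"
      unfolding T_def using lborel_integral_real_affine[of 1 "\<lambda>t. indicator {y + c<..} t * f t" c] by simp
    also have "\<dots> = (LINT t|lborel. indicator {y<..} t * f (t + c))"
      by (intro Bochner_Integration.integral_cong) (auto simp: indicator_def add.commute)
    finally show ?thesis .
  qed
  have intc: "integrable lborel (\<lambda>t. indicator {y<..} t * f (t + c))" for y
    using integrable_mult_indicator[OF _ lborel_integrable_real_affine[OF int, of 1 c], of "{y<..}"]
    by (simp add: add.commute)
  show "((\<lambda>y. T (y + c) / T y) \<longlongrightarrow> L) at_top"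
  proof (rule tendstoI)
    fix e :: real assume e: "e > 0"
    then obtain Y where Y: "\<And>t. t \<ge> Y \<Longrightarrow> \<bar>f (t + c) / f t - L\<bar> < e / 2"
      using tendstoD[OF lim, of "e / 2"] by (auto simp: eventually_at_top_linorder dist_real_def)
    show "eventually (\<lambda>y. dist (T (y + c) / T y) L < e) at_top"
      using eventually_ge_at_top[of "max Y 0"]
    proof eventually_elim
      case (elim y)
      have bd: "\<bar>f (t + c) - L * f t\<bar> \<le> e / 2 * f t" if "t > y" for t
      proof -
        have ft: "f t > 0" using pos[of t] that elim by simp
        then have "f (t + c) - L * f t = (f (t + c) / f t - L) * f t" by (simp add: field_simps)
        then have "\<bar>f (t + c) - L * f t\<bar> = \<bar>f (t + c) / f t - L\<bar> * f t" using ft by (simp add: abs_mult)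
        then show ?thesis using Y[of t] that elim ft by (simp add: mult_right_mono)
      qed
      have "T (y + c) - L * T y = (LINT t|lborel. indicator {y<..} t * (f (t + c) - L * f t))"
        unfolding shift unfolding T_def using int'[of y] intc[of y]
        by (simp add: right_diff_distrib mult.left_commute[of _ L])
      moreover have "\<bar>\<dots>\<bar> \<le> (LINT t|lborel. e / 2 * (indicator {y<..} t * f t))"
      proof (rule order_trans[OF integral_abs_bound integral_mono'])
        show "integrable lborel (\<lambda>t. e / 2 * (indicator {y<..} t * f t))"
          using int'[of y] by (rule integrable_mult_right)
      qed (use bd order_trans[OF abs_ge_zero bd] in \<open>auto simp: indicator_def\<close>)
      ultimately have "\<bar>T (y + c) - L * T y\<bar> \<le> e / 2 * T y" unfolding T_def by simp
      moreover have p: "T y > 0" using Tpos elim by simp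
      moreover have "T (y + c) / T y - L = (T (y + c) - L * T y) / T y" using p by (simp add: field_simps)
      ultimately have "\<bar>T (y + c) / T y - L\<bar> \<le> e / 2" by (simp add: abs_divide divide_le_eq)
      then show ?case using e by (simp add: dist_real_def)
    qed
  qed
qed

text \<open>The hypothesis forces \<open>F n\<close> to 1, so logarithms are available eventually,
  and \<open>ln (F n)\<close> lies between \<open>1 - 1 / F n\<close> and \<open>F n - 1\<close>.
  Both bounds times \<open>n\<close> tend to \<open>- l\<close>.\<close>

lemma tendsto_power_exp_minus:
  fixes F :: "nat \<Rightarrow> real"
  assumes u: "(\<lambda>n. real n * (1 - F n)) \<longlonglongrightarrow> l"
  shows "(\<lambda>n. F n ^ n) \<longlonglongrightarrow> exp (- l)"
proof -
  have "(\<lambda>n. 1 - real n * (1 - F n) * inverse (real n)) \<longlonglongrightarrow> 1 - l * 0"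
    by (intro tendsto_intros u tendsto_inverse_0_at_top filterlim_real_sequentially)
  moreover have "eventually (\<lambda>n. 1 - real n * (1 - F n) * inverse (real n) = F n) sequentially"
    using eventually_gt_at_top[of 0] by eventually_elim (simp add: field_simps)
  ultimately have F1: "F \<longlonglongrightarrow> 1" using Lim_transform_eventually by fastforce
  then have Fpos: "eventually (\<lambda>n. F n > 0) sequentially" by (rule order_tendstoD) simp
  have "(\<lambda>n. real n * ln (F n)) \<longlonglongrightarrow> - l"
  proof (rule tendsto_sandwich)
    show "(\<lambda>n. - (real n * (1 - F n) / F n)) \<longlonglongrightarrow> - l"
      using tendsto_minus[OF tendsto_divide[OF u F1]] by simp
    show "(\<lambda>n. - (real n * (1 - F n))) \<longlonglongrightarrow> - l" by (rule tendsto_minus[OF u])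
    show "eventually (\<lambda>n. - (real n * (1 - F n) / F n) \<le> real n * ln (F n)) sequentially"
      using Fpos
    proof eventually_elim
      case (elim n)
      then have "ln (inverse (F n)) \<le> inverse (F n) - 1" by (intro ln_le_minus_one) simp
      then have "- ln (F n) \<le> inverse (F n) - 1" using elim by (simp only: ln_inverse)
      then have "- ((1 - F n) / F n) \<le> ln (F n)" using elim by (simp add: field_simps)
      from mult_left_mono[OF this, of "real n"] show ?case by simp
    qed
    show "eventually (\<lambda>n. real n * ln (F n) \<le> - (real n * (1 - F n))) sequentially"
      using Fpos
    proof eventually_elim
      case (elim n)
      from mult_left_mono[OF ln_le_minus_one[OF this], of "real n"] show ?case by (simp add: algebra_simps)
    qed
  qed
  then have "(\<lambda>n. exp (real n * ln (F n))) \<longlonglongrightarrow> exp (- l)" by (rule tendsto_exp)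
  moreover have "eventually (\<lambda>n. exp (real n * ln (F n)) = F n ^ n) sequentially"
    using Fpos by eventually_elim (simp add: exp_of_nat_mult)
  ultimately show ?thesis by (rule Lim_transform_eventually)
qed

text \<open>With \<open>b n\<close> a quantile at level \<open>1 - 1 / n\<close>, dividing by
  \<open>1 - F (b n)\<close> is multiplying by \<open>n\<close>. The tail ratio at
  \<open>c = B * x\<close> thus says that \<open>n * (1 - F (b n + B * x))\<close> tends to
  \<open>exp (- x)\<close>.\<close>

lemma gumbel_domain_of_attraction:
  fixes F :: "real \<Rightarrow> real"
  assumes cont: "\<And>x. isCont F x" and mono: "mono F"
    and top: "(F \<longlongrightarrow> 1) at_top" and bot: "(F \<longlongrightarrow> 0) at_bot"
    and lt1: "\<And>x. F x < 1"
    and ratio: "\<And>c. ((\<lambda>y. (1 - F (y + c)) / (1 - F y)) \<longlongrightarrow> exp (- c / B)) at_top"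
    and B: "B > 0"
  shows "\<exists>b. \<forall>x. (\<lambda>n. F (b n + B * x) ^ n) \<longlonglongrightarrow> exp (- exp (- x))"
proof -
  \<comment> \<open>For \<open>n = 1\<close> the level would be 0, which \<open>F\<close> need not
    attain; from 2 on it lies strictly between the limits of \<open>F\<close>.\<close>
  have "\<exists>y. F y = 1 - 1 / real n" if n: "n \<ge> 2" for n :: nat
  proof -
    have "eventually (\<lambda>y. F y > 1 - 1 / real n) at_top" using n by (intro order_tendstoD[OF top]) auto
    moreover have "eventually (\<lambda>y. F y < 1 - 1 / real n) at_bot" using n by (intro order_tendstoD[OF bot]) auto
    ultimately obtain u v where uv: "F u > 1 - 1 / real n" "F v < 1 - 1 / real n"
      using eventually_happens'[OF trivial_limit_at_bot_linorder] eventually_happens'[OF trivial_limit_at_top_linorder] by metis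
    then have "v \<le> u" using monoD[OF mono, of u v] by linarith
    then show ?thesis using IVT[of F v "1 - 1 / real n" u] uv cont by auto
  qed
  then obtain b where b: "\<And>n. n \<ge> 2 \<Longrightarrow> F (b n) = 1 - 1 / real n" by metis
  \<comment> \<open>Since \<open>F Z < 1\<close> for every \<open>Z\<close>, the levels eventually
    exceed \<open>F Z\<close>, and monotonicity pushes \<open>b n\<close> beyond
    \<open>Z\<close>.\<close>
  have "filterlim b at_top sequentially"
    unfolding filterlim_at_top
  proof
    fix Z
    have "(\<lambda>n. 1 - 1 / real n) \<longlonglongrightarrow> 1 - 0" by (intro tendsto_intros lim_const_over_n)
    then have "eventually (\<lambda>n. 1 - 1 / real n > F Z) sequentially"
      using lt1[of Z] by (intro order_tendstoD) auto
    then show "eventually (\<lambda>n. Z \<le> b n) sequentially" using eventually_ge_at_top[of 2]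
    proof eventually_elim
      case (elim n)
      then show ?case using b[of n] monoD[OF mono, of "b n" Z] by linarith
    qed
  qed
  from filterlim_compose[OF ratio this]
  have lim: "(\<lambda>n. (1 - F (b n + B * x)) / (1 - F (b n))) \<longlonglongrightarrow> exp (- (B * x) / B)" for x .
  have "(\<lambda>n. F (b n + B * x) ^ n) \<longlonglongrightarrow> exp (- exp (- x))" for x
  proof (rule tendsto_power_exp_minus, rule Lim_transform_eventually)
    show "(\<lambda>n. (1 - F (b n + B * x)) / (1 - F (b n))) \<longlonglongrightarrow> exp (- x)"
      using lim[of x] B by simp
    show "eventually (\<lambda>n. (1 - F (b n + B * x)) / (1 - F (b n)) = real n * (1 - F (b n + B * x))) sequentially"
      using eventually_ge_at_top[of 2] by eventually_elim (simp add: b)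
  qed
  then show ?thesis by auto
qed

section \<open>Application to maxima of independent variables\<close>

theorem corollary5:
  fixes S :: nat and \<alpha> \<beta> :: "nat \<Rightarrow> real"
    and M :: "'a measure" and X :: "nat \<Rightarrow> 'a \<Rightarrow> real"
  assumes "S \<ge> 1"
    and "\<And>s. s \<in> {1..S} \<Longrightarrow> \<alpha> s > 0"
    and "\<And>s. s \<in> {1..S} \<Longrightarrow> \<beta> s > 0"
    and "prob_space M"
    and "prob_space.indep_vars M (\<lambda>_. borel) X {1..}"
    and "\<And>r. r \<ge> 1 \<Longrightarrow> distributed M lborel (X r) (\<lambda>y. ennreal (moschopoulos_density S \<alpha> \<beta> y))"
  shows "\<exists>a b :: nat \<Rightarrow> real. (\<forall>R\<ge>1. a R > 0) \<and>
    (\<forall>x::real. (\<lambda>R. measure M {\<omega> \<in> space M.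
        (Max ((\<lambda>r. X r \<omega>) ` {1..R}) - b R) / a R \<le> x}) \<longlonglongrightarrow> exp (- exp (- x)))"
proof -
  interpret moschopoulos S \<alpha> \<beta> using assms(1-3) by unfold_locales
  interpret prob_space M by fact
  define f where "f = moschopoulos_density S \<alpha> \<beta>"
  have D: "distributed M lborel (X r) (\<lambda>y. ennreal (f y))" if "r \<ge> 1" for r
    using assms(6)[OF that] by (simp add: f_def)
  have f0: "f y \<ge> 0" for y
    using density_pos[of y] by (cases "y > 0") (auto simp: f_def moschopoulos_density_def)
  have fm[measurable]: "f \<in> borel_measurable borel"
    using distributed_real_measurable[OF _ D[of 1]] f0 by simp
  define \<mu> where "\<mu> = density lborel (\<lambda>y. ennreal (f y))"
  have \<mu>: "distr M borel (X r) = \<mu>" if "r \<ge> 1" for r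
    using distributed_distr_eq_density[OF D[OF that]] by (simp add: \<mu>_def cong: distr_cong)
  have Xm[measurable]: "random_variable borel (X r)" if "r \<ge> 1" for r
    using distributed_measurable[OF D[OF that]] by simp
  interpret mu: real_distribution \<mu>
    using real_distribution_distr[OF Xm[of 1]] unfolding \<mu>[OF order_refl] by simp
  \<comment> \<open>The total mass is read off from the law of \<open>X 1\<close>, so the series
    never has to be integrated.\<close>
  have one: "(\<integral>\<^sup>+ y. ennreal (f y) \<partial>lborel) = 1"
    using mu.emeasure_space_1 by (simp add: \<mu>_def emeasure_density)
  have int: "integrable lborel f"
    using one f0 by (intro integrableI_nonneg) auto
  have cdf: "cdf \<mu> t = prob (X r -` {..t} \<inter> space M)" if "r \<ge> 1" for r t
    unfolding cdf_def2 \<mu>[OF that, symmetric] by (rule measure_distr) (use that in auto)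
  have tail: "1 - cdf \<mu> y = (LINT t|lborel. indicator {y<..} t * f t)" for y
  proof -
    have "1 - cdf \<mu> y = measure \<mu> {y<..}"
      unfolding cdf_def2 using mu.prob_compl[of "{..y}"] by (simp add: Compl_eq_Diff_UNIV[symmetric])
    also have "\<dots> = (LINT t|\<mu>. indicator {y<..} t)" by simp
    also have "\<dots> = (LINT t|lborel. f t * indicator {y<..} t)"
      unfolding \<mu>_def using f0 by (subst integral_real_density) auto
    finally show ?thesis by (simp add: mult.commute)
  qed
  \<comment> \<open>Folding with \<open>tail\<close> restates the results on tail integrals in terms
    of \<open>1 - cdf \<mu>\<close>.\<close>
  note T = tail_integral_ratio[OF int, folded tail]
  have fpos: "y > 0 \<Longrightarrow> f y > 0" for y using density_pos by (simp add: f_def)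
  have ratio: "((\<lambda>y. f (y + c) / f y) \<longlongrightarrow> exp (- c / bmax)) at_top" for c
    using density_ratio by (simp add: f_def)
  have "\<exists>b. \<forall>x. (\<lambda>n. cdf \<mu> (b n + bmax * x) ^ n) \<longlonglongrightarrow> exp (- exp (- x))"
  proof (rule gumbel_domain_of_attraction)
    have "emeasure \<mu> {x} = 0" for x
      unfolding \<mu>_def by (subst emeasure_density) (auto intro!: nn_integral_null_set)
    then show "isCont (cdf \<mu>) x" for x
      unfolding mu.isCont_cdf measure_def by simp
    show "mono (cdf \<mu>)" by (auto intro!: monoI mu.cdf_nondecreasing)
    \<comment> \<open>Positivity of the tail is available at nonnegative points, hence the passage
      to \<open>max x 0\<close>; the shift 0 merely instantiates the limit premise.\<close>
    show "cdf \<mu> x < 1" for x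
      using T(2)[OF fpos ratio[of 0], of "max x 0"] mu.cdf_nondecreasing[of x "max x 0"] by simp
    show "((\<lambda>y. (1 - cdf \<mu> (y + c)) / (1 - cdf \<mu> y)) \<longlongrightarrow> exp (- c / bmax)) at_top" for c
      by (rule T(1)[OF fpos ratio])
  qed (fact bmax_pos mu.cdf_lim_at_top_prob mu.cdf_lim_at_bot)+
  then obtain b where b: "\<And>x. (\<lambda>n. cdf \<mu> (b n + bmax * x) ^ n) \<longlonglongrightarrow> exp (- exp (- x))" by auto
  have "measure M {\<omega> \<in> space M. (Max ((\<lambda>r. X r \<omega>) ` {1..R}) - b R) / bmax \<le> x} = cdf \<mu> (b R + bmax * x) ^ R"
    if R: "R \<ge> 1" for R x
  proof -
    let ?t = "b R + bmax * x"
    have "{\<omega> \<in> space M. (Max ((\<lambda>r. X r \<omega>) ` {1..R}) - b R) / bmax \<le> x}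
        = (\<Inter>r\<in>{1..R}. X r -` {..?t} \<inter> space M)"
    proof -
      have "(Max ((\<lambda>r. X r \<omega>) ` {1..R}) - b R) / bmax \<le> x \<longleftrightarrow> Max ((\<lambda>r. X r \<omega>) ` {1..R}) \<le> ?t" for \<omega>
        using bmax_pos by (auto simp: divide_le_eq algebra_simps)
      also have "\<dots> \<omega> \<longleftrightarrow> (\<forall>r\<in>{1..R}. X r \<omega> \<le> ?t)" for \<omega>
        using R by (subst Max_le_iff) auto
      finally show ?thesis using R by auto
    qed
    also have "prob \<dots> = (\<Prod>r\<in>{1..R}. prob (X r -` {..?t} \<inter> space M))"
      using R by (intro indep_varsD[OF assms(5)]) auto
    also have "\<dots> = (\<Prod>r\<in>{1..R}. cdf \<mu> ?t)"
      by (intro prod.cong refl cdf[symmetric]) auto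
    finally show ?thesis by simp
  qed
  \<comment> \<open>The identity is restricted to \<open>R\<close> at least 1, because for
    \<open>R = 0\<close> the maximum is taken over the empty set.\<close>
  then have "eventually (\<lambda>R. cdf \<mu> (b R + bmax * x) ^ R =
      measure M {\<omega> \<in> space M. (Max ((\<lambda>r. X r \<omega>) ` {1..R}) - b R) / bmax \<le> x}) sequentially" for x
    by (intro eventually_mono[OF eventually_ge_at_top[of 1]]) (rule sym)
  from Lim_transform_eventually[OF b this] bmax_pos show ?thesis
    by (intro exI[of _ "\<lambda>_. bmax"] exI[of _ b]) auto
qed

end
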